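(* Let $f:\mathbb{R}^n\to\mathbb{R}$ be twice continuously differentiable and bounded from below, and let $\{x_k\}$ be generated by the regularized quasi-Newton method described in the context, with matrices $B_k\in\mathbb{R}^{n\times n}$ such that $\{B_k\}$ is a bounded sequence. Write $g_k:=\nabla f(x_k)$. Then $$\liminf_{k\to\infty}\|g_k\|=0.$$ In particular, given any $\varepsilon>0$, the algorithm (with stopping criterion $\|g_k\|<\varepsilon$) terminates with $\|g_k\|<\varepsilon$ after finitely many iterations.
   Context: Notation: $\|\cdot\|$ is the Euclidean norm, $I$ the $n\times n$ identity, $g_k:=\nabla f(x_k)$. Regularized quasi-Newton method. Choose $x_0\in\mathbb{R}^n$ and parameters $\mu_0>0$; $p_{\min},c_1\in(0,1)$; $c_2\in(c_1,1)$; $\sigma_1\in(0,1)$; $\sigma_2>1$. For $k=0,1,2,\ldots$: Step 1. If a suitable stopping criterion is satisfied, terminate. (For asymptotic statements, the algorithm is considered as running without termination and producing an infinite sequence $\{x_k\}$.) Step 2 (step computation). Choose $B_k\in\mathbb{R}^{n\times n}$ (arbitrary; in particular not required to be symmetric, positive definite, or an approximation of the Hessian) and attempt to solve $(B_k+\mu_k I)d_k=-g_k$ for $d_k\in\mathbb{R}^n$. For a solution $d_k$, the predicted reduction is $$\mathrm{pred}_k:=-g_k^{\mathsf T}d_k-\tfrac12 d_k^{\mathsf T}B_kd_k=\tfrac{\mu_k}{2}\|d_k\|^2-\tfrac12 g_k^{\mathsf T}d_k.$$ If the equation admits no solution $d_k$, or if $\mathrm{pred}_k\le p_{\min}\|g_k\|\,\|d_k\|$,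 set $x_{k+1}:=x_k$, $\mu_{k+1}:=\sigma_2\mu_k$ and go to Step 4. Otherwise go to Step 3. Step 3 (variable update). Let $\mathrm{ared}_k:=f(x_k)-f(x_k+d_k)$ and $\varrho_k:=\mathrm{ared}_k/\mathrm{pred}_k$. - If $\varrho_k\le c_1$: set $x_{k+1}:=x_k$, $\mu_{k+1}:=\sigma_2\mu_k$. - If $c_1<\varrho_k\le c_2$ (successful step): set $x_{k+1}:=x_k+d_k$, $\mu_{k+1}:=\mu_k$. - If $c_2<\varrho_k$ (highly successful step): set $x_{k+1}:=x_k+d_k$, $\mu_{k+1}:=\sigma_1\mu_k$. Step 4. Replace $k$ by $k+1$ and go to Step 1. *)

theory Defs
  imports "HOL-Analysis.Analysis"
begin

text \<open>The value is meaningful only where \<open>f\<close> is differentiable; see \<open>GDERIV_gradient\<close> below.\<close>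

definition gradient :: "('a::real_inner \<Rightarrow> real) \<Rightarrow> 'a \<Rightarrow> 'a" where
  "gradient f x = (THE D. GDERIV f x :> D)"

lemma GDERIV_unique:
  fixes f :: "'a::real_inner \<Rightarrow> real"
  assumes "GDERIV f x :> D" "GDERIV f x :> E"
  shows "D = E"
proof -
  have "(\<lambda>h. h \<bullet> D) = (\<lambda>h. h \<bullet> E)"
    using assms unfolding gderiv_def by (rule has_derivative_unique)
  then have "h \<bullet> D = h \<bullet> E" for h
    by (rule fun_cong)
  then show ?thesis
    using vector_eq_rdot[of D E] by (simp add: inner_commute)
qed

lemma gradient_eqI: "GDERIV f x :> D \<Longrightarrow> gradient f x = D"
  unfolding gradient_def by (rule the_equality) (auto intro: GDERIV_unique simp del: gderiv_deriv)

lemma GDERIV_gradient: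
  fixes f :: "'a::euclidean_space \<Rightarrow> real"
  assumes "f differentiable (at x)"
  shows "GDERIV f x :> gradient f x"
proof -
  from assms obtain f' where f': "(f has_derivative f') (at x)"
    unfolding differentiable_def by blast
  then have lin: "linear f'"
    by (rule has_derivative_linear)
  have "f' = (\<lambda>h. h \<bullet> adjoint f' 1)"
  proof
    fix h
    show "f' h = h \<bullet> adjoint f' 1"
      using adjoint_works[OF lin, of h 1] by simp
  qed
  with f' have *: "GDERIV f x :> adjoint f' 1"
    unfolding gderiv_def by simp
  show ?thesis
    unfolding gradient_eqI[OF *] by (rule *)
qed

text \<open>The Jacobian of the gradient is the Hessian matrix; its continuity is with respect to the
  Euclidean topology on matrices.\<close>

definition twice_continuously_differentiable :: "(real ^ 'n \<Rightarrow> real) \<Rightarrow> bool" where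
  "twice_continuously_differentiable f \<longleftrightarrow>
     (\<forall>x. f differentiable (at x)) \<and>
     (\<forall>x. gradient f differentiable (at x)) \<and>
     continuous_on UNIV (\<lambda>x. jacobian (gradient f) (at x))"

definition solves_step_equation ::
    "(real ^ 'n \<Rightarrow> real) \<Rightarrow> real ^ 'n \<Rightarrow> real \<Rightarrow> real ^ 'n ^ 'n \<Rightarrow> real ^ 'n \<Rightarrow> bool" where
  "solves_step_equation f x \<mu> B d \<longleftrightarrow> (B + \<mu> *\<^sub>R mat 1) *v d = - gradient f x"

definition pred_red ::
    "(real ^ 'n \<Rightarrow> real) \<Rightarrow> real ^ 'n \<Rightarrow> real ^ 'n ^ 'n \<Rightarrow> real ^ 'n \<Rightarrow> real" where
  "pred_red f x B d = - (gradient f x \<bullet> d) - 1 / 2 * (d \<bullet> (B *v d))"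

definition actual_red :: "(real ^ 'n \<Rightarrow> real) \<Rightarrow> real ^ 'n \<Rightarrow> real ^ 'n \<Rightarrow> real" where
  "actual_red f x d = f x - f (x + d)"

text \<open>One iteration, from \<open>(x, \<mu>)\<close> to \<open>(x', \<mu>')\<close>, with chosen matrix \<open>B\<close>. If the step equation is
  solvable, \<open>d\<close> is one of its (possibly many) solutions; otherwise \<open>d\<close> is irrelevant. Whenever
  the quotient is evaluated, the predicted reduction is positive.\<close>

definition rqn_step ::
    "real \<Rightarrow> real \<Rightarrow> real \<Rightarrow> real \<Rightarrow> real \<Rightarrow> (real ^ 'n \<Rightarrow> real) \<Rightarrow>
     real ^ 'n \<Rightarrow> real \<Rightarrow> real ^ 'n ^ 'n \<Rightarrow> real ^ 'n \<Rightarrow> real ^ 'n \<Rightarrow> real \<Rightarrow> bool" where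
  "rqn_step p_min c1 c2 \<sigma>1 \<sigma>2 f x \<mu> B d x' \<mu>' \<longleftrightarrow>
     (if \<nexists>s. solves_step_equation f x \<mu> B s then x' = x \<and> \<mu>' = \<sigma>2 * \<mu>
      else
        solves_step_equation f x \<mu> B d \<and>
        (if pred_red f x B d \<le> p_min * norm (gradient f x) * norm d
         then x' = x \<and> \<mu>' = \<sigma>2 * \<mu>
         else
           (let \<rho> = actual_red f x d / pred_red f x B d in
              if \<rho> \<le> c1 then x' = x \<and> \<mu>' = \<sigma>2 * \<mu>
              else if \<rho> \<le> c2 then x' = x + d \<and> \<mu>' = \<mu>
              else x' = x + d \<and> \<mu>' = \<sigma>1 * \<mu>)))"

text \<open>Iteration \<open>k\<close> is carried out iff the stopping criterion failed for all iterates up to \<open>x k\<close>.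
  After termination the sequences are left unspecified, so terminating and nonterminating runs are
  described uniformly; \<open>stop = (\<lambda>_. False)\<close> gives the algorithm without termination.\<close>

definition iteration_performed :: "('a \<Rightarrow> bool) \<Rightarrow> (nat \<Rightarrow> 'a) \<Rightarrow> nat \<Rightarrow> bool" where
  "iteration_performed stop x k \<longleftrightarrow> (\<forall>j\<le>k. \<not> stop (x j))"

definition rqn_run ::
    "(real ^ 'n \<Rightarrow> bool) \<Rightarrow> real \<Rightarrow> real \<Rightarrow> real \<Rightarrow> real \<Rightarrow> real \<Rightarrow> (real ^ 'n \<Rightarrow> real) \<Rightarrow>
     real ^ 'n \<Rightarrow> real \<Rightarrow> (nat \<Rightarrow> real ^ 'n) \<Rightarrow> (nat \<Rightarrow> real) \<Rightarrow> (nat \<Rightarrow> real ^ 'n ^ 'n) \<Rightarrow>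
     (nat \<Rightarrow> real ^ 'n) \<Rightarrow> bool" where
  "rqn_run stop p_min c1 c2 \<sigma>1 \<sigma>2 f x0 \<mu>0 x \<mu> B d \<longleftrightarrow>
     x 0 = x0 \<and> \<mu> 0 = \<mu>0 \<and>
     (\<forall>k. iteration_performed stop x k \<longrightarrow>
        rqn_step p_min c1 c2 \<sigma>1 \<sigma>2 f (x k) (\<mu> k) (B k) (d k) (x (Suc k)) (\<mu> (Suc k)))"

end

theory Submission
  imports Defs
begin

text \<open>Suppose that \<open>norm (g\<^sub>k) \<ge> \<epsilon>\<close> along a run. An accepted step decreases \<open>f\<close> by at least
  \<open>c1 * p_min * \<epsilon> * norm (d\<^sub>k)\<close>, so the iterates have finite total length and converge. For large \<open>\<mu>\<^sub>k\<close>
  the steps are short, and since \<open>\<nabla>f\<close> varies little near the limit point, they are highly successful.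
  Hence \<open>\<mu>\<close> is bounded, so accepted steps have length bounded away from \<open>0\<close> and there are only finitely
  many of them; but then \<open>\<mu>\<close> grows geometrically, a contradiction.\<close>

section \<open>Matrix bounds and the regularized linear system\<close>

text \<open>Cauchy-Schwarz is applied to each row, and the Euclidean norm is bounded by the sum of
  the entries. Here \<open>norm A\<close> is the Frobenius norm; the factor is crude, but any
  constant depending only on the dimension will do.\<close>

lemma norm_matrix_vector_mult_le:
  fixes A :: "real ^ 'n ^ 'm"
  shows "norm (A *v x) \<le> real CARD('m) * norm A * norm x"
proof -
  have "\<bar>(A *v x) $ i\<bar> \<le> norm A * norm x" for i
  proof -
    have "(A *v x) $ i = A $ i \<bullet> x"
      by (simp add: matrix_vector_mult_def inner_vec_def)
    also have "\<bar>\<dots>\<bar> \<le> norm (A $ i) * norm x"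
      by (rule Cauchy_Schwarz_ineq2)
    also have "\<dots> \<le> norm A * norm x"
      by (intro mult_right_mono Finite_Cartesian_Product.norm_nth_le) auto
    finally show ?thesis .
  qed
  then have "(\<Sum>i\<in>UNIV. \<bar>(A *v x) $ i\<bar>) \<le> (\<Sum>i\<in>(UNIV :: 'm set). norm A * norm x)"
    by (intro sum_mono)
  with norm_le_l1_cart[of "A *v x"] show ?thesis
    by simp
qed

text \<open>Turns boundedness of the chosen matrices into one constant \<open>M\<close>, through
  which they enter all later estimates.\<close>

lemma bounded_matrices_uniform_bound:
  fixes S :: "(real ^ 'n ^ 'm) set"
  assumes "bounded S"
  obtains M where "M \<ge> 0" "\<And>A v. A \<in> S \<Longrightarrow> norm (A *v v) \<le> M * norm v"
proof -
  from assms obtain b where b: "b > 0" "\<And>A. A \<in> S \<Longrightarrow> norm A \<le> b"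
    unfolding bounded_pos by blast
  show thesis
  proof
    show "0 \<le> real CARD('m) * b"
      using b by simp
    show "norm (A *v v) \<le> real CARD('m) * b * norm v" if "A \<in> S" for A v
      by (rule order_trans[OF norm_matrix_vector_mult_le])
        (intro mult_right_mono mult_left_mono b that, auto)
  qed
qed

lemma shifted_matrix_vector_mult:
  fixes B :: "real ^ 'n ^ 'n"
  shows "(B + \<mu> *\<^sub>R mat 1) *v d = B *v d + \<mu> *\<^sub>R d"
  by (simp add: matrix_vector_mult_add_rdistrib scaleR_matrix_vector_assoc[symmetric])

lemma solves_step_equation_iff:
  "solves_step_equation f x \<mu> B d \<longleftrightarrow> gradient f x + B *v d = - (\<mu> *\<^sub>R d)"
  unfolding solves_step_equation_def shifted_matrix_vector_mult
  by (simp add: eq_neg_iff_add_eq_0 add_ac)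

text \<open>A kernel vector \<open>v\<close> would satisfy
  \<open>B *v v = - (\<mu> *\<^sub>R v)\<close>, which is too long for the bound \<open>M\<close>
  unless \<open>v = 0\<close>. The square matrix is thus injective, hence surjective.\<close>

lemma step_equation_solvable:
  fixes B :: "real ^ 'n ^ 'n"
  assumes B: "\<And>v. norm (B *v v) \<le> M * norm v" and "M < \<mu>" "0 < \<mu>"
  shows "\<exists>d. solves_step_equation f x \<mu> B d"
proof -
  let ?A = "B + \<mu> *\<^sub>R mat 1"
  have "v = 0" if "?A *v v = 0" for v
  proof (rule ccontr)
    assume "v \<noteq> 0"
    from that have "B *v v = - (\<mu> *\<^sub>R v)"
      by (simp add: shifted_matrix_vector_mult eq_neg_iff_add_eq_0)
    then have "\<mu> * norm v \<le> M * norm v"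
      using B[of v] \<open>0 < \<mu>\<close> by simp
    with \<open>v \<noteq> 0\<close> \<open>M < \<mu>\<close> show False
      by simp
  qed
  then have "inj ((*v) ?A)"
    by (subst linear_injective_0) auto
  then have "surj ((*v) ?A)"
    by (intro linear_injective_imp_surjective) auto
  then show ?thesis
    unfolding solves_step_equation_def by (metis surjD)
qed

text \<open>Both bounds are the triangle inequality applied to
  \<open>gradient f x + B *v d = - (\<mu> *\<^sub>R d)\<close>. The first prevents short steps while
  \<mu> is bounded and the gradient is not small; the second forces short steps when \<mu> is
  large.\<close>

lemma step_norm_bounds:
  assumes B: "\<And>v. norm (B *v v) \<le> M * norm v" and "0 < \<mu>"
    and solves: "solves_step_equation f x \<mu> B d"
  shows "norm (gradient f x) \<le> (\<mu> + M) * norm d"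
    and "(\<mu> - M) * norm d \<le> norm (gradient f x)"
proof -
  have eq: "gradient f x + B *v d = - (\<mu> *\<^sub>R d)"
    using solves by (simp add: solves_step_equation_iff)
  have "norm (gradient f x + B *v d) = \<mu> * norm d"
    unfolding eq using \<open>0 < \<mu>\<close> by simp
  moreover have "norm (gradient f x) \<le> norm (gradient f x + B *v d) + norm (B *v d)"
    using norm_triangle_ineq4[of "gradient f x + B *v d" "B *v d"] by simp
  moreover have "norm (gradient f x + B *v d) \<le> norm (gradient f x) + norm (B *v d)"
    by (rule norm_triangle_ineq)
  ultimately show "norm (gradient f x) \<le> (\<mu> + M) * norm d"
    and "(\<mu> - M) * norm d \<le> norm (gradient f x)"
    using B[of d] by (simp_all add: algebra_simps)
qed

section \<open>Predicted and actual reduction\<close>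

lemma abs_quadratic_form_le:
  fixes B :: "real ^ 'n ^ 'n"
  assumes B: "\<And>v. norm (B *v v) \<le> M * norm v"
  shows "\<bar>d \<bullet> (B *v d)\<bar> \<le> M * (norm d)\<^sup>2"
proof -
  have "\<bar>d \<bullet> (B *v d)\<bar> \<le> norm d * norm (B *v d)"
    by (rule Cauchy_Schwarz_ineq2)
  also have "\<dots> \<le> norm d * (M * norm d)"
    by (intro mult_left_mono B) auto
  finally show ?thesis
    by (simp add: power2_eq_square mult_ac)
qed

text \<open>The inner product of the step equation with \<open>d\<close> eliminates the gradient:
  the predicted reduction equals
  \<open>\<mu> * (norm d)\<^sup>2 + d \<bullet> (B *v d) / 2\<close>.\<close>

lemma pred_red_ge:
  assumes B: "\<And>v. norm (B *v v) \<le> M * norm v"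
    and solves: "solves_step_equation f x \<mu> B d"
  shows "(\<mu> - M / 2) * (norm d)\<^sup>2 \<le> pred_red f x B d"
proof -
  have "gradient f x + B *v d = - (\<mu> *\<^sub>R d)"
    using solves by (simp add: solves_step_equation_iff)
  then have "(gradient f x + B *v d) \<bullet> d = - \<mu> * (norm d)\<^sup>2"
    by (simp add: power2_norm_eq_inner)
  then have "- (gradient f x \<bullet> d) = \<mu> * (norm d)\<^sup>2 + d \<bullet> (B *v d)"
    by (simp add: inner_add_left inner_commute[of "B *v d" d])
  then have "pred_red f x B d = \<mu> * (norm d)\<^sup>2 + d \<bullet> (B *v d) / 2"
    unfolding pred_red_def by simp
  with abs_quadratic_form_le[OF B, of d] show ?thesis
    by (simp add: algebra_simps abs_le_iff)
qed

text \<open>Both sides are compared with \<open>(norm d)\<^sup>2\<close>: the left is at most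
  \<open>p * (\<mu> + M)\<close> times it, the right at least \<open>\<mu> - M / 2\<close> times it.
  The threshold on \<mu> separates the two factors, since
  \<open>p * M + M / 2 \<le> 2 * M\<close>.\<close>

lemma pred_red_large:
  assumes B: "\<And>v. norm (B *v v) \<le> M * norm v" and "0 \<le> M" "0 < \<mu>" "0 < p" "p < 1"
    and \<mu>: "2 * M < (1 - p) * \<mu>"
    and solves: "solves_step_equation f x \<mu> B d" and "gradient f x \<noteq> 0"
  shows "p * norm (gradient f x) * norm d < pred_red f x B d"
proof -
  note g = step_norm_bounds(1)[OF B \<open>0 < \<mu>\<close> solves]
  have "d \<noteq> 0"
    using g \<open>gradient f x \<noteq> 0\<close> by auto
  have "p * M \<le> 1 * M"
    using \<open>p < 1\<close> \<open>0 \<le> M\<close> by (intro mult_right_mono) auto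
  then have "p * (\<mu> + M) < \<mu> - M / 2"
    using \<mu> \<open>0 \<le> M\<close> by (simp add: algebra_simps)
  have "p * norm (gradient f x) * norm d \<le> p * ((\<mu> + M) * norm d) * norm d"
    using g \<open>0 < p\<close> by (intro mult_right_mono mult_left_mono) auto
  also have "\<dots> = (p * (\<mu> + M)) * (norm d)\<^sup>2"
    by (simp add: power2_eq_square)
  also have "\<dots> < (\<mu> - M / 2) * (norm d)\<^sup>2"
    using \<open>p * (\<mu> + M) < \<mu> - M / 2\<close> \<open>d \<noteq> 0\<close> by (intro mult_strict_right_mono) auto
  also have "\<dots> \<le> pred_red f x B d"
    by (rule pred_red_ge[OF B solves])
  finally show ?thesis .
qed

text \<open>The first-order terms of the two reductions cancel. What remains is the linearization
  error of \<open>f\<close>, controlled by the variation \<kappa> of the gradient along the segment,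
  and half the quadratic form.\<close>

lemma abs_actual_minus_pred_red_le:
  assumes diff: "\<And>y. f differentiable (at y)"
    and B: "\<And>v. norm (B *v v) \<le> M * norm v"
    and near: "\<And>y. y \<in> closed_segment x (x + d) \<Longrightarrow> norm (gradient f y - gradient f x) \<le> \<kappa>"
  shows "\<bar>actual_red f x d - pred_red f x B d\<bar> \<le> (\<kappa> + M / 2 * norm d) * norm d"
proof -
  have "norm (f (x + d) - f x - (x + d - x) \<bullet> gradient f x) \<le> norm (x + d - x) * \<kappa>"
  proof (rule differentiable_bound_linearization[where S = "closed_segment x (x + d)"
        and f' = "\<lambda>y h. h \<bullet> gradient f y"])
    show "(f has_derivative (\<lambda>h. h \<bullet> gradient f y)) (at y within closed_segment x (x + d))" for y
      using GDERIV_gradient[OF diff] unfolding gderiv_def by (rule has_derivative_at_withinI)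
    show "x + t *\<^sub>R (x + d - x) \<in> closed_segment x (x + d)" if "t \<in> {0..1}" for t
      using that by (auto simp: in_segment algebra_simps intro!: exI[of _ t])
    show "onorm ((\<lambda>h. h \<bullet> gradient f y) - (\<lambda>h. h \<bullet> gradient f x)) \<le> \<kappa>"
      if y: "y \<in> closed_segment x (x + d)" for y
      unfolding fun_diff_def
    proof (rule onorm_bound)
      show "0 \<le> \<kappa>"
        using near[OF y] by (rule order_trans[OF norm_ge_zero])
      show "norm (h \<bullet> gradient f y - h \<bullet> gradient f x) \<le> \<kappa> * norm h" for h
      proof -
        have "\<bar>h \<bullet> (gradient f y - gradient f x)\<bar> \<le> norm h * norm (gradient f y - gradient f x)"
          by (rule Cauchy_Schwarz_ineq2)
        also have "\<dots> \<le> norm h * \<kappa>"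
          by (intro mult_left_mono near y) auto
        finally show ?thesis
          by (simp add: inner_diff_right mult.commute)
      qed
    qed
  qed auto
  then have "\<bar>f (x + d) - f x - d \<bullet> gradient f x\<bar> \<le> \<kappa> * norm d"
    by (simp add: mult.commute)
  moreover have "actual_red f x d - pred_red f x B d
      = - (f (x + d) - f x - d \<bullet> gradient f x) + d \<bullet> (B *v d) / 2"
    unfolding actual_red_def pred_red_def by (simp add: inner_commute)
  ultimately have "\<bar>actual_red f x d - pred_red f x B d\<bar> \<le> \<kappa> * norm d + M * (norm d)\<^sup>2 / 2"
    using abs_quadratic_form_le[OF B, of d] by (simp add: abs_le_iff)
  then show ?thesis
    by (simp add: power2_eq_square algebra_simps)
qed

section \<open>Outcomes of a single iteration\<close>

text \<open>Merges the three reasons for rejection and the two degrees of success. After the test on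
  the predicted reduction its value is positive, so the ratio test can be stated without a
  quotient.\<close>

lemma rqn_step_cases:
  assumes "rqn_step p_min c1 c2 \<sigma>1 \<sigma>2 f x \<mu> B d x' \<mu>'" "0 < p_min"
  obtains (rejected) "x' = x" "\<mu>' = \<sigma>2 * \<mu>"
  | (accepted) "x' = x + d" "\<mu>' = \<mu> \<or> \<mu>' = \<sigma>1 * \<mu>" "solves_step_equation f x \<mu> B d"
      "p_min * norm (gradient f x) * norm d < pred_red f x B d"
      "c1 * pred_red f x B d < actual_red f x d"
proof -
  have "c1 * pred_red f x B d < actual_red f x d"
    if "p_min * norm (gradient f x) * norm d < pred_red f x B d"
      "c1 < actual_red f x d / pred_red f x B d"
  proof -
    have "0 \<le> p_min * norm (gradient f x) * norm d"
      using assms(2) by simp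
    with that show ?thesis
      by (simp add: pos_less_divide_eq)
  qed
  then show thesis
    using assms(1) rejected accepted
    unfolding rqn_step_def Let_def by (smt (verit))
qed

lemma rqn_step_regularization_pos:
  assumes "rqn_step p_min c1 c2 \<sigma>1 \<sigma>2 f x \<mu> B d x' \<mu>'" "0 < p_min" "0 < \<sigma>1" "0 < \<sigma>2" "0 < \<mu>"
  shows "0 < \<mu>'"
  using assms(1,2) by (cases rule: rqn_step_cases) (use assms in auto)

text \<open>The two estimates are assumed only for a \<open>d\<close> that solves the step equation;
  \<open>solvable\<close> is what lets \<open>rqn_step\<close> guarantee this of the given
  \<open>d\<close>.\<close>

lemma rqn_step_highly_successful:
  assumes step: "rqn_step p_min c1 c2 \<sigma>1 \<sigma>2 f x \<mu> B d x' \<mu>'"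
    and "0 < p_min" "c1 < c2"
    and solvable: "\<exists>s. solves_step_equation f x \<mu> B s"
    and pred: "solves_step_equation f x \<mu> B d \<Longrightarrow>
      p_min * norm (gradient f x) * norm d < pred_red f x B d"
    and ared: "solves_step_equation f x \<mu> B d \<Longrightarrow> c2 * pred_red f x B d < actual_red f x d"
  shows "\<mu>' = \<sigma>1 * \<mu>"
proof -
  have solves: "solves_step_equation f x \<mu> B d"
    using step solvable unfolding rqn_step_def by auto
  have "0 \<le> p_min * norm (gradient f x) * norm d"
    using \<open>0 < p_min\<close> by simp
  with pred[OF solves] have "0 < pred_red f x B d"
    by linarith
  with ared[OF solves] have "c2 < actual_red f x d / pred_red f x B d"
    by (simp add: pos_less_divide_eq)
  then show ?thesis
    using step solvable pred[OF solves] \<open>c1 < c2\<close> unfolding rqn_step_def by (auto simp: Let_def)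
qed

lemma twice_continuously_differentiable_continuous_gradient:
  "twice_continuously_differentiable f \<Longrightarrow> isCont (gradient f) x"
  unfolding twice_continuously_differentiable_def by (auto intro: differentiable_imp_continuous_within)

section \<open>Sequences of finite length and of limited growth\<close>

text \<open>The decreases telescope, so the total length is at most \<open>(F 0 - L) / c\<close> for
  any lower bound \<open>L\<close> of \<open>F\<close>. The increments are then absolutely summable,
  and completeness gives the limit.\<close>

lemma convergent_if_step_bounded_by_decrease:
  fixes x :: "nat \<Rightarrow> 'a::banach" and F :: "nat \<Rightarrow> real"
  assumes "0 < c" and decrease: "\<And>k. c * norm (x (Suc k) - x k) \<le> F k - F (Suc k)"
    and "bdd_below (range F)"
  shows "convergent x"
proof -
  from \<open>bdd_below (range F)\<close> obtain L where L: "\<And>k. L \<le> F k"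
    unfolding bdd_below_def by auto
  have "(\<Sum>k<n. norm (x (Suc k) - x k)) \<le> (F 0 - L) / c" for n
  proof -
    have "c * (\<Sum>k<n. norm (x (Suc k) - x k)) \<le> (\<Sum>k<n. F k - F (Suc k))"
      unfolding sum_distrib_left by (intro sum_mono decrease)
    also have "\<dots> = F 0 - F n"
      by (rule sum_lessThan_telescope')
    finally show ?thesis
      using L[of n] \<open>0 < c\<close> by (simp add: pos_le_divide_eq mult.commute)
  qed
  then have "summable (\<lambda>k. norm (x (Suc k) - x k))"
    by (intro summableI_nonneg_bounded) auto
  then have "summable (\<lambda>k. x (Suc k) - x k)"
    by (rule summable_norm_cancel)
  then have "convergent (\<lambda>n. x n - x 0)"
    unfolding summable_iff_convergent sum_lessThan_telescope .
  then have "convergent (\<lambda>n. (x n - x 0) + x 0)"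
    by (intro convergent_add convergent_const)
  then show ?thesis
    by simp
qed

text \<open>From a value at most \<open>m\<close>, one step leads to at most
  \<open>\<sigma> * m\<close>; above \<open>m\<close> there is no increase from index
  \<open>N\<close> on.\<close>

lemma eventually_bounded_above_if_growth_limited:
  fixes \<mu> :: "nat \<Rightarrow> real"
  assumes growth: "\<And>k. \<mu> (Suc k) \<le> \<sigma> * \<mu> k" and "0 \<le> \<sigma>"
    and decr: "\<And>k. k \<ge> N \<Longrightarrow> m < \<mu> k \<Longrightarrow> \<mu> (Suc k) \<le> \<mu> k"
  shows "\<exists>U. \<forall>k\<ge>N. \<mu> k \<le> U"
proof (intro exI allI impI)
  show "\<mu> k \<le> max (\<mu> N) (\<sigma> * m)" if "N \<le> k" for k
    using that
  proof (induction k rule: dec_induct)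
    case (step k)
    show ?case
    proof (cases "m < \<mu> k")
      case True
      then show ?thesis
        using decr[of k] step by linarith
    next
      case False
      then have "\<sigma> * \<mu> k \<le> \<sigma> * m"
        using \<open>0 \<le> \<sigma>\<close> by (intro mult_left_mono) auto
      then show ?thesis
        using growth[of k] by linarith
    qed
  qed simp
qed

section \<open>Contradiction from gradients bounded away from zero\<close>

text \<open>No starting point is fixed, and the initial regularization is any positive number, so
  the result applies to every tail of a run.\<close>

lemma gradient_not_bounded_away_from_0:
  fixes f :: "real ^ 'n \<Rightarrow> real"
  assumes params: "0 < p_min" "p_min < 1" "0 < c1" "c1 < c2" "c2 < 1"
      "0 < \<sigma>1" "\<sigma>1 < 1" "1 < \<sigma>2"
    and diff: "\<And>y. f differentiable (at y)" and cont: "\<And>y. isCont (gradient f) y"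
    and below: "bdd_below (range f)"
    and step: "\<And>k. rqn_step p_min c1 c2 \<sigma>1 \<sigma>2 f (x k) (\<mu> k) (B k) (d k) (x (Suc k)) (\<mu> (Suc k))"
    and "0 < \<mu> 0" and "bounded (range B)" and "0 < \<epsilon>"
  shows "\<exists>k. norm (gradient f (x k)) < \<epsilon>"
proof (rule ccontr)
  assume "\<not> ?thesis"
  then have g: "\<epsilon> \<le> norm (gradient f (x k))" for k
    by (simp add: not_less)
  from \<open>bounded (range B)\<close> obtain M where "0 \<le> M" and M: "\<And>k v. norm (B k *v v) \<le> M * norm v"
    by (rule bounded_matrices_uniform_bound) blast

  have \<mu>_pos: "0 < \<mu> k" for k
  proof (induction k)
    case (Suc k)
    then show ?case
      using rqn_step_regularization_pos[OF step] params by simp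
  qed fact
  have \<mu>_growth: "\<mu> (Suc k) \<le> \<sigma>2 * \<mu> k" for k
  proof -
    have "\<mu> k \<le> \<sigma>2 * \<mu> k" "\<sigma>1 * \<mu> k \<le> \<sigma>2 * \<mu> k"
      using \<mu>_pos[of k] params by auto
    with step[of k] \<open>0 < p_min\<close> show ?thesis
      by (cases rule: rqn_step_cases) auto
  qed

  have "convergent x"
  proof (rule convergent_if_step_bounded_by_decrease)
    show "0 < c1 * (p_min * \<epsilon>)"
      using params \<open>0 < \<epsilon>\<close> by simp
    show "bdd_below (range (\<lambda>k. f (x k)))"
      using below by (rule bdd_below_mono) auto
    show "c1 * (p_min * \<epsilon>) * norm (x (Suc k) - x k) \<le> f (x k) - f (x (Suc k))" for k
      using step[of k] \<open>0 < p_min\<close>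
    proof (cases rule: rqn_step_cases)
      case accepted
      have "c1 * (p_min * \<epsilon>) * norm (d k) = c1 * (p_min * \<epsilon> * norm (d k))"
        by simp
      also have "\<dots> \<le> c1 * (p_min * norm (gradient f (x k)) * norm (d k))"
        using params g by (intro mult_left_mono mult_right_mono) auto
      also have "\<dots> \<le> c1 * pred_red f (x k) (B k) (d k)"
        using params accepted(4) by (intro mult_left_mono) auto
      also have "\<dots> \<le> actual_red f (x k) (d k)"
        using accepted(5) by simp
      finally show ?thesis
        using accepted(1) by (simp add: actual_red_def)
    qed auto
  qed
  then obtain z where z: "x \<longlonglongrightarrow> z"
    by (auto simp: convergent_def)

  \<comment> \<open>Chosen so that \<open>4 * \<eta> * norm d\<close> is at most
    \<open>1 - c2\<close> times the predicted reduction, which exceeds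
    \<open>p_min * \<epsilon> * norm d\<close>. An error of that size in the reduction still gives a
    ratio above \<open>c2\<close>.\<close>
  define \<eta> where "\<eta> = (1 - c2) * p_min * \<epsilon> / 4"
  have "0 < \<eta>"
    using params \<open>0 < \<epsilon>\<close> by (simp add: \<eta>_def)
  from cont[of z] \<open>0 < \<eta>\<close> obtain \<delta> where "0 < \<delta>"
    and \<delta>: "\<And>y. dist y z < \<delta> \<Longrightarrow> dist (gradient f y) (gradient f z) < \<eta>"
    unfolding continuous_at_eps_delta by blast
  \<comment> \<open>Half of \<delta> is kept in reserve for the step: the whole segment must stay
    within \<delta> of \<open>z\<close>.\<close>
  from z \<open>0 < \<delta>\<close> obtain N where N: "\<And>k. N \<le> k \<Longrightarrow> dist (x k) z < \<delta> / 2"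
    unfolding lim_sequentially by (meson half_gt_zero)
  define G where "G = norm (gradient f z) + \<eta>"
  \<comment> \<open>Target step length: the first term keeps the segment near \<open>z\<close>, the
    second makes the quadratic part of the error at most \<eta>. The denominator
    \<open>M + 1\<close> is positive even when \<open>M = 0\<close>.\<close>
  define r where "r = min (\<delta> / 2) (\<eta> / (M + 1))"
  have "0 < r" "0 \<le> G"
    using \<open>0 < \<delta>\<close> \<open>0 < \<eta>\<close> \<open>0 \<le> M\<close> by (auto simp: r_def G_def)
  \<comment> \<open>Beyond the first term, \<open>(\<mu> k - M) * norm (d k) \<le> G\<close> forces
    \<open>norm (d k) \<le> r\<close>; beyond the second, \<open>pred_red_large\<close>
    applies.\<close>
  define m where "m = max (M + G / r) (2 * M / (1 - p_min))"

  have "\<mu> (Suc k) \<le> \<mu> k" if "N \<le> k" "m < \<mu> k" for k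
  proof -
    have "M + G / r < \<mu> k" "2 * M / (1 - p_min) < \<mu> k"
      using that(2) by (auto simp: m_def)
    moreover have "0 \<le> G / r"
      using \<open>0 < r\<close> \<open>0 \<le> G\<close> by simp
    ultimately have "M < \<mu> k"
      by linarith
    have \<mu>r: "G \<le> (\<mu> k - M) * r" and \<mu>p: "2 * M < (1 - p_min) * \<mu> k"
      using \<open>M + G / r < \<mu> k\<close> \<open>2 * M / (1 - p_min) < \<mu> k\<close> \<open>0 < r\<close> params
      by (auto simp: field_simps)
    have near_x: "dist (x k) z < \<delta> / 2"
      by (rule N[OF that(1)])
    have "dist (gradient f (x k)) (gradient f z) < \<eta>"
      using near_x \<open>0 < \<delta>\<close> by (intro \<delta>) simp
    then have gk: "norm (gradient f (x k)) \<le> G"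
      unfolding G_def dist_norm by norm
    have pred: "p_min * norm (gradient f (x k)) * norm (d k) < pred_red f (x k) (B k) (d k)"
      if "solves_step_equation f (x k) (\<mu> k) (B k) (d k)"
      using M \<open>0 \<le> M\<close> \<mu>_pos params(1,2) \<mu>p that
    proof (rule pred_red_large)
      show "gradient f (x k) \<noteq> 0"
        using g[of k] \<open>0 < \<epsilon>\<close> by auto
    qed
    have "\<mu> (Suc k) = \<sigma>1 * \<mu> k"
      using step[of k] params(1,4)
    proof (rule rqn_step_highly_successful)
      show "\<exists>s. solves_step_equation f (x k) (\<mu> k) (B k) s"
        using M \<open>M < \<mu> k\<close> \<mu>_pos by (rule step_equation_solvable)
    next
      assume solves: "solves_step_equation f (x k) (\<mu> k) (B k) (d k)"
      have "(\<mu> k - M) * norm (d k) \<le> (\<mu> k - M) * r"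
        using step_norm_bounds(2)[OF M \<mu>_pos solves] gk \<mu>r by linarith
      then have "norm (d k) \<le> r"
        using \<open>M < \<mu> k\<close> by simp
      then have d_small: "norm (d k) \<le> \<delta> / 2" "(M + 1) * norm (d k) \<le> \<eta>"
        using \<open>0 \<le> M\<close> by (auto simp: r_def field_simps)
      \<comment> \<open>Both gradients lie within \<eta> of the gradient at \<open>z\<close>, whence
        the factor 2.\<close>
      have "norm (gradient f y - gradient f (x k)) \<le> 2 * \<eta>"
        if "y \<in> closed_segment (x k) (x k + d k)" for y
      proof -
        have "dist (x k) y \<le> norm (d k)"
          using dist_in_closed_segment[OF that] by (simp add: dist_norm norm_minus_commute)
        then have "dist y z < \<delta>"
          using d_small(1) near_x by metric
        then have "dist (gradient f y) (gradient f z) < \<eta>"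
          by (rule \<delta>)
        with \<open>dist (gradient f (x k)) (gradient f z) < \<eta>\<close> show ?thesis
          unfolding dist_norm by norm
      qed
      then have "\<bar>actual_red f (x k) (d k) - pred_red f (x k) (B k) (d k)\<bar>
          \<le> (2 * \<eta> + M / 2 * norm (d k)) * norm (d k)"
        by (intro abs_actual_minus_pred_red_le diff M)
      also have "\<dots> \<le> 4 * \<eta> * norm (d k)"
      proof (intro mult_right_mono)
        have "M / 2 * norm (d k) \<le> (M + 1) * norm (d k)"
          using \<open>0 \<le> M\<close> by (intro mult_right_mono) auto
        then show "2 * \<eta> + M / 2 * norm (d k) \<le> 4 * \<eta>"
          using d_small(2) \<open>0 < \<eta>\<close> by linarith
      qed simp
      also have "\<dots> = (1 - c2) * (p_min * \<epsilon> * norm (d k))"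
        by (simp add: \<eta>_def)
      also have "\<dots> \<le> (1 - c2) * (p_min * norm (gradient f (x k)) * norm (d k))"
        using params g by (intro mult_left_mono mult_right_mono) auto
      also have "\<dots> < (1 - c2) * pred_red f (x k) (B k) (d k)"
        using params pred[OF solves] by (intro mult_strict_left_mono) auto
      finally show "c2 * pred_red f (x k) (B k) (d k) < actual_red f (x k) (d k)"
        by (simp add: algebra_simps)
    qed (rule pred)
    then show ?thesis
      using \<mu>_pos[of k] params by simp
  qed
  with \<mu>_growth obtain U where U: "\<And>k. N \<le> k \<Longrightarrow> \<mu> k \<le> U"
    using eventually_bounded_above_if_growth_limited[of \<mu> \<sigma>2 N m] params by auto
  have "0 < U"
    using U[of N] \<mu>_pos[of N] by simp

  have "(\<lambda>k. norm (x (Suc k) - x k)) \<longlonglongrightarrow> 0"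
    using tendsto_diff[OF LIMSEQ_Suc[OF z] z] by (intro tendsto_norm_zero) simp
  \<comment> \<open>The threshold is the least length of an accepted step when \<mu> is at most
    \<open>U\<close> and the gradient norm at least \<epsilon>.\<close>
  then have "\<forall>\<^sub>F k in sequentially. norm (x (Suc k) - x k) < \<epsilon> / (U + M)"
    using \<open>0 < U\<close> \<open>0 \<le> M\<close> \<open>0 < \<epsilon>\<close> by (intro order_tendstoD) auto
  then obtain K where K: "\<And>k. K \<le> k \<Longrightarrow> norm (x (Suc k) - x k) < \<epsilon> / (U + M)"
    unfolding eventually_sequentially by blast
  define L where "L = max K N"
  have "\<mu> (Suc k) = \<sigma>2 * \<mu> k" if "L \<le> k" for k
    using step[of k] \<open>0 < p_min\<close>
  proof (cases rule: rqn_step_cases)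
    \<comment> \<open>This case is contradictory from \<open>L\<close> on, so only rejections
      remain, and each multiplies \<mu> by \<sigma>2.\<close>
    case accepted
    have "\<epsilon> \<le> (\<mu> k + M) * norm (d k)"
      using step_norm_bounds(1)[OF M \<mu>_pos accepted(3)] g[of k] by linarith
    also have "\<dots> \<le> (U + M) * norm (d k)"
      using U[of k] that by (intro mult_right_mono) (auto simp: L_def)
    finally have "\<epsilon> / (U + M) \<le> norm (d k)"
      using \<open>0 < U\<close> \<open>0 \<le> M\<close> by (simp add: pos_divide_le_eq mult.commute)
    with K[of k] that accepted(1) show ?thesis
      by (simp add: L_def)
  qed
  then have \<mu>_geometric: "\<mu> (L + n) = \<sigma>2 ^ n * \<mu> L" for n
    by (induction n) auto
  obtain n where "U / \<mu> L < \<sigma>2 ^ n"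
    using real_arch_pow[OF \<open>1 < \<sigma>2\<close>] by blast
  then have "U < \<mu> (L + n)"
    using \<mu>_pos[of L] by (simp add: \<mu>_geometric pos_divide_less_eq)
  then show False
    using U[of "L + n"] by (simp add: L_def trans_le_add1)
qed

section \<open>From one small gradient to the limit inferior and to termination\<close>

theorem theorem3p4:
  fixes f :: "real ^ 'n \<Rightarrow> real"
    and x0 :: "real ^ 'n"
    and \<mu>0 p_min c1 c2 \<sigma>1 \<sigma>2 :: real
  assumes "\<mu>0 > 0"
    and "0 < p_min" "p_min < 1"
    and "0 < c1" "c1 < 1"
    and "c1 < c2" "c2 < 1"
    and "0 < \<sigma>1" "\<sigma>1 < 1"
    and "\<sigma>2 > 1"
    and "twice_continuously_differentiable f"
    and "bdd_below (range f)"
  shows "(\<forall>x \<mu> B d.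
            rqn_run (\<lambda>_. False) p_min c1 c2 \<sigma>1 \<sigma>2 f x0 \<mu>0 x \<mu> B d \<and> bounded (range B) \<longrightarrow>
            liminf (\<lambda>k. ereal (norm (gradient f (x k)))) = 0)
       \<and> (\<forall>\<epsilon>>0. \<forall>x \<mu> B d.
            rqn_run (\<lambda>y. norm (gradient f y) < \<epsilon>) p_min c1 c2 \<sigma>1 \<sigma>2 f x0 \<mu>0 x \<mu> B d \<and>
            bounded {B k | k. iteration_performed (\<lambda>y. norm (gradient f y) < \<epsilon>) x k} \<longrightarrow>
            (\<exists>K. norm (gradient f (x K)) < \<epsilon> \<and> (\<forall>j<K. \<not> norm (gradient f (x j)) < \<epsilon>)))"
proof (intro conjI allI impI; elim conjE)
  note params = assms(2-4,6-10)
  have diff: "f differentiable (at y)" for y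
    using assms(11) unfolding twice_continuously_differentiable_def by blast
  note stationary = gradient_not_bounded_away_from_0[OF params diff
      twice_continuously_differentiable_continuous_gradient[OF assms(11)] assms(12)]
  {
    fix x \<mu> B d
    assume run: "rqn_run (\<lambda>_. False) p_min c1 c2 \<sigma>1 \<sigma>2 f x0 \<mu>0 x \<mu> B d" and "bounded (range B)"
    then have step: "rqn_step p_min c1 c2 \<sigma>1 \<sigma>2 f (x k) (\<mu> k) (B k) (d k) (x (Suc k)) (\<mu> (Suc k))" for k
      unfolding rqn_run_def iteration_performed_def by simp
    have \<mu>_pos: "0 < \<mu> k" for k
    proof (induction k)
      case 0
      then show ?case
        using run \<open>0 < \<mu>0\<close> unfolding rqn_run_def by simp
    next
      case (Suc k)
      then show ?case
        using rqn_step_regularization_pos[OF step] params by simp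
    qed
    have frequently_small: "\<exists>k\<ge>N. norm (gradient f (x k)) < \<epsilon>" if "0 < \<epsilon>" for \<epsilon> N
    proof -
      \<comment> \<open>The tail from \<open>N\<close> is again a run with positive initial
        regularization, so small gradients recur beyond every index.\<close>
      have "\<exists>k. norm (gradient f (x (k + N))) < \<epsilon>"
      proof (rule stationary)
        show "rqn_step p_min c1 c2 \<sigma>1 \<sigma>2 f (x (k + N)) (\<mu> (k + N)) (B (k + N)) (d (k + N))
            (x (Suc k + N)) (\<mu> (Suc k + N))" for k
          using step[of "k + N"] by simp
        show "bounded (range (\<lambda>k. B (k + N)))"
          using \<open>bounded (range B)\<close> by (rule bounded_subset) auto
      qed (use \<mu>_pos that in auto)
      then show ?thesis
        using le_add2 by blast
    qed
    show "liminf (\<lambda>k. ereal (norm (gradient f (x k)))) = 0"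
    proof (rule antisym)
      show "liminf (\<lambda>k. ereal (norm (gradient f (x k)))) \<le> 0"
      proof (rule ccontr)
        assume "\<not> ?thesis"
        then obtain e where "0 < ereal e" "ereal e < liminf (\<lambda>k. ereal (norm (gradient f (x k))))"
          using ereal_dense2[of 0] by (auto simp: not_le)
        then have "\<forall>\<^sub>F k in sequentially. ereal e < ereal (norm (gradient f (x k)))"
          by (blast dest: less_LiminfD)
        then obtain N where "\<And>k. N \<le> k \<Longrightarrow> e < norm (gradient f (x k))"
          unfolding eventually_sequentially by auto
        with frequently_small[of e N] \<open>0 < ereal e\<close> show False
          by force
      qed
      show "0 \<le> liminf (\<lambda>k. ereal (norm (gradient f (x k))))"
        by (intro Liminf_bounded always_eventually) auto
    qed
  next
    fix \<epsilon> :: real and x \<mu> B d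
    let ?stop = "\<lambda>y. norm (gradient f y) < \<epsilon>"
    assume "0 < \<epsilon>" and run: "rqn_run ?stop p_min c1 c2 \<sigma>1 \<sigma>2 f x0 \<mu>0 x \<mu> B d"
      and bounded: "bounded {B k | k. iteration_performed ?stop x k}"
    have "\<exists>K. ?stop (x K)"
    proof (rule ccontr)
      assume never: "\<not> ?thesis"
      \<comment> \<open>If the criterion never holds, every iteration is carried out; the step
        relation then holds at all indices, and the bounded set of used matrices is all of
        \<open>range B\<close>.\<close>
      then have performed: "iteration_performed ?stop x k" for k
        unfolding iteration_performed_def by blast
      have "\<exists>K. ?stop (x K)"
      proof (rule stationary)
        show "rqn_step p_min c1 c2 \<sigma>1 \<sigma>2 f (x k) (\<mu> k) (B k) (d k) (x (Suc k)) (\<mu> (Suc k))" for k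
          using run performed unfolding rqn_run_def by blast
        show "0 < \<mu> 0"
          using run \<open>0 < \<mu>0\<close> unfolding rqn_run_def by simp
        show "bounded (range B)"
          using bounded performed by (simp add: full_SetCompr_eq)
      qed fact
      with never show False ..
    qed
    \<comment> \<open>Termination happens at the least index that meets the criterion.\<close>
    then show "\<exists>K. ?stop (x K) \<and> (\<forall>j<K. \<not> ?stop (x j))"
      using exists_least_iff[of "\<lambda>K. ?stop (x K)"] by blast
  }
qed

end
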